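(* Let $X$ and $Y$ be distributive lattices and assume that $Y$ is conditionally complete and satisfies the dual to the infinite distributive law, that is, $y\vee\inf S=\inf\{y\vee s\colon s\in S\}$ for every $y\in Y$ and every nonempty $S\subset Y$ bounded from below. Assume moreover that there is a function $\mathcal{N}\colon Y\to 2^Y$ (assigning to each element of $Y$ a subset of $Y$), each of whose values is a bounded set, and which satisfies the following conditions: (i) $y\in\mathcal{N}(y)$ for each $y\in Y$; (ii) for all $t,u,y,z\in Y$, if $t,u\in\mathcal{N}(z)$ and $t\leq y\leq u$, then $y\in\mathcal{N}(z)$; (iii) $\sup\mathcal{N}(y)\in \mathcal{N}(y)$ and $\inf \mathcal{N}(y)\in \mathcal{N}(y)$ for each $y\in Y$; (iv) for all $t,u,y,z\in Y$, if $t\in \mathcal{N}(u)$ and $u\vee y\in \mathcal{N}(z)$, then $t\vee y\in \mathcal{N}(z)$. Then for every map $f\colon X\to Y$ satisfying $$f(x)\vee f(y)\in\mathcal{N}(f(x\vee y))\quad\text{for all }x,y\in X$$ there exists a join homomorphism $F\colon X\to Y$ such that $F(x)\in \mathcal{N}(f(x))$ for every $x\in X$.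
   Context: A lattice is called conditionally complete if every nonempty bounded subset of it admits a least upper bound and a greatest lower bound. A map $F\colon X\to Y$ between lattices is called a join homomorphism if $F(x\vee y)=F(x)\vee F(y)$ for all $x,y\in X$. *)

theory Defs
  imports Main
begin

definition join_homomorphism :: "('a::lattice \<Rightarrow> 'b::lattice) \<Rightarrow> bool" where
  "join_homomorphism F \<longleftrightarrow> (\<forall>x y. F (sup x y) = sup (F x) (F y))"

definition dual_infinite_distributive :: "'b::conditionally_complete_lattice itself \<Rightarrow> bool" where
  "dual_infinite_distributive _ \<longleftrightarrow>
     (\<forall>(y::'b) S. S \<noteq> {} \<longrightarrow> bdd_below S \<longrightarrow> sup y (Inf S) = Inf ((\<lambda>s. sup y s) ` S))"

end

theory Submission
  imports Defs
begin

text \<open>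
  First make \<open>f\<close> monotone by passing to \<open>g x = sup {f z | z \<le> x}\<close>, which stays in \<open>N (f x)\<close>;
  then let \<open>F x\<close> be the infimum of the values \<open>g x\<^sub>1 \<squnion> \<dots> \<squnion> g x\<^sub>n\<close> over all decompositions
  \<open>x = x\<^sub>1 \<squnion> \<dots> \<squnion> x\<^sub>n\<close>. By (iv) all these values lie in \<open>N (f x)\<close>, hence so does \<open>F x\<close>. Joining
  decompositions of \<open>x\<close> and \<open>y\<close> gives \<open>F (x \<squnion> y) \<le> F x \<squnion> F y\<close> by the dual infinite
  distributive law; restricting a decomposition of \<open>x \<squnion> y\<close> to \<open>x\<close> and to \<open>y\<close>, which is possible
  as \<open>X\<close> is distributive, gives the reverse inequality as \<open>g\<close> is monotone.
\<close>

text \<open>\<open>decomp_value g x a\<close> says that \<open>a = g x\<^sub>1 \<squnion> \<dots> \<squnion> g x\<^sub>n\<close> for some \<open>x\<^sub>1 \<squnion> \<dots> \<squnion> x\<^sub>n = x\<close>, \<open>n \<ge> 1\<close>.\<close>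

inductive decomp_value :: "('a::lattice \<Rightarrow> 'b::lattice) \<Rightarrow> 'a \<Rightarrow> 'b \<Rightarrow> bool"
  for g where
  single: "decomp_value g x (g x)"
| join: "decomp_value g x a \<Longrightarrow> decomp_value g y b \<Longrightarrow> decomp_value g (sup x y) (sup a b)"

text \<open>Meet each part with \<open>w\<close>: by distributivity the results join to
  \<open>w\<close>, and monotonicity of \<open>g\<close> lowers each value.\<close>

lemma decomp_value_restrict:
  fixes g :: "'a::distrib_lattice \<Rightarrow> 'b::lattice"
  assumes "mono g" "decomp_value g z c" "w \<le> z"
  obtains a where "decomp_value g w a" "a \<le> c"
proof -
  have "\<exists>a. decomp_value g w a \<and> a \<le> c"
    using assms(2,3)
  proof (induction arbitrary: w)
    case (single z)
    then show ?case using decomp_value.single monoD[OF assms(1)] by blast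
  next
    case (join x a y b)
    obtain a' where a': "decomp_value g (inf w x) a'" "a' \<le> a"
      using join.IH(1) inf_le2 by blast
    obtain b' where b': "decomp_value g (inf w y) b'" "b' \<le> b"
      using join.IH(2) inf_le2 by blast
    have "sup (inf w x) (inf w y) = w"
      using join.prems by (metis inf_sup_distrib1 inf.absorb1)
    then have "decomp_value g w (sup a' b')"
      using decomp_value.join[OF a'(1) b'(1)] by simp
    then show ?case using sup_mono[OF a'(2) b'(2)] by blast
  qed
  then show thesis using that by blast
qed

text \<open>Apply the law to \<open>B\<close> with \<open>a\<close> fixed, then to \<open>A\<close>
  with \<open>Inf B\<close> fixed.\<close>

lemma Inf_sup_Inf_greatest:
  fixes A B :: "'b::conditionally_complete_lattice set"
  assumes dist: "dual_infinite_distributive TYPE('b)"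
    and A: "A \<noteq> {}" "bdd_below A" and B: "B \<noteq> {}" "bdd_below B"
    and le: "\<And>a b. a \<in> A \<Longrightarrow> b \<in> B \<Longrightarrow> c \<le> sup a b"
  shows "c \<le> sup (Inf A) (Inf B)"
proof -
  have eq: "sup y (Inf S) = Inf (sup y ` S)" if "S \<noteq> {}" "bdd_below S" for y :: 'b and S
    using dist that unfolding dual_infinite_distributive_def by blast
  have "c \<le> sup a (Inf B)" if "a \<in> A" for a
    unfolding eq[OF B] using B(1) le[OF that] by (intro cInf_greatest) auto
  then have "c \<le> sup (Inf B) (Inf A)"
    unfolding eq[OF A] using A(1) by (intro cInf_greatest) (auto simp: sup_commute)
  then show ?thesis by (simp add: sup_commute)
qed

lemma join_homomorphism_Inf_decomp_value:
  fixes g :: "'a::distrib_lattice \<Rightarrow> 'b::conditionally_complete_lattice"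
  assumes dist: "dual_infinite_distributive TYPE('b)"
    and g: "mono g"
    and bdd: "\<And>x. bdd_below {a. decomp_value g x a}"
  shows "join_homomorphism (\<lambda>x. Inf {a. decomp_value g x a})"
proof -
  let ?F = "\<lambda>x. Inf {a. decomp_value g x a}"
  have ne: "{a. decomp_value g x a} \<noteq> {}" for x
    using decomp_value.single by blast
  have upper: "?F (sup x y) \<le> sup (?F x) (?F y)" for x y
    by (rule Inf_sup_Inf_greatest[OF dist ne bdd ne bdd])
       (auto intro: cInf_lower bdd decomp_value.join)
  have mono: "?F x \<le> ?F z" if "x \<le> z" for x z
  proof (rule cInf_greatest[OF ne])
    fix c assume "c \<in> {a. decomp_value g z a}"
    then obtain a where a: "decomp_value g x a" "a \<le> c"
      using decomp_value_restrict[OF g _ \<open>x \<le> z\<close>] by blast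
    have "?F x \<le> a" using a(1) by (intro cInf_lower bdd) simp
    then show "?F x \<le> c" using a(2) by simp
  qed
  have "?F (sup x y) = sup (?F x) (?F y)" for x y
    by (intro antisym upper le_supI mono sup_ge1 sup_ge2)
  then show ?thesis unfolding join_homomorphism_def by blast
qed

theorem theorem8:
  fixes N :: "'b::{distrib_lattice, conditionally_complete_lattice} \<Rightarrow> 'b set"
    and f :: "'a::distrib_lattice \<Rightarrow> 'b"
  assumes dist: "dual_infinite_distributive TYPE('b)"
    and bounded: "\<And>y. bdd_below (N y) \<and> bdd_above (N y)"
    and i: "\<And>y. y \<in> N y"
    and ii: "\<And>t u y z. t \<in> N z \<Longrightarrow> u \<in> N z \<Longrightarrow> t \<le> y \<Longrightarrow> y \<le> u \<Longrightarrow> y \<in> N z"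
    and iii: "\<And>y. Sup (N y) \<in> N y \<and> Inf (N y) \<in> N y"
    and iv: "\<And>t u y z. t \<in> N u \<Longrightarrow> sup u y \<in> N z \<Longrightarrow> sup t y \<in> N z"
    and f: "\<And>x y. sup (f x) (f y) \<in> N (f (sup x y))"
  shows "\<exists>F :: 'a \<Rightarrow> 'b. join_homomorphism F \<and> (\<forall>x. F x \<in> N (f x))"
proof -
  \<comment> \<open>In \<open>sup (f x) (f y)\<close>, (iv) replaces \<open>f x\<close> by
    \<open>a\<close>, then \<open>f y\<close> by \<open>b\<close>.\<close>
  have sup_in: "sup a b \<in> N (f (sup x y))" if "a \<in> N (f x)" "b \<in> N (f y)" for a b x y
    using iv[OF that(2), of a] iv[OF that(1) f, of y] by (simp only: sup_commute[of _ a])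
  define g where "g = (\<lambda>x. Sup (f ` {..x}))"
  have f_le: "f z \<le> Sup (N (f x))" if "z \<le> x" for x z
  proof -
    \<comment> \<open>Here \<open>sup z x = x\<close>.\<close>
    have "sup (f z) (f x) \<in> N (f x)"
      using f[of z x] that by (simp add: sup.absorb2)
    then have "sup (f z) (f x) \<le> Sup (N (f x))"
      using bounded by (intro cSup_upper) auto
    then show ?thesis by simp
  qed
  have bdd: "bdd_above (f ` {..x})" for x
    using f_le by (intro bdd_aboveI) auto
  have g_in: "g x \<in> N (f x)" for x
  proof (rule ii[OF i])
    show "Sup (N (f x)) \<in> N (f x)" using iii by blast
    show "f x \<le> g x" unfolding g_def by (intro cSup_upper bdd) simp
    show "g x \<le> Sup (N (f x))" unfolding g_def using f_le by (intro cSup_least) auto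
  qed
  have mono: "mono g"
    unfolding g_def by (intro monoI cSup_subset_mono bdd image_mono) auto
  have decomp_in: "a \<in> N (f x)" if "decomp_value g x a" for x a
    using that by induction (simp_all add: g_in sup_in)
  have bdd_decomp: "bdd_below {a. decomp_value g x a}" for x
    by (rule bdd_below_mono[of "N (f x)"]) (auto simp: bounded decomp_in)
  have "Inf {a. decomp_value g x a} \<in> N (f x)" for x
  proof (rule ii)
    show "Inf (N (f x)) \<in> N (f x)" using iii by blast
    \<comment> \<open>The one-part decomposition supplies the upper end for (ii).\<close>
    show "g x \<in> N (f x)" by (rule g_in)
    show "Inf (N (f x)) \<le> Inf {a. decomp_value g x a}"
      using decomp_value.single by (intro cInf_superset_mono) (auto simp: bounded decomp_in)
    show "Inf {a. decomp_value g x a} \<le> g x"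
      by (intro cInf_lower bdd_decomp) (simp add: decomp_value.single)
  qed
  then show ?thesis
    using join_homomorphism_Inf_decomp_value[OF dist mono bdd_decomp] by blast
qed

end
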